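(* Let $a\in\mathbb{R}^n\setminus\{0\}$, $b\in\mathbb{R}$, $\gamma>0$, $\mu>0$, and let $\mathcal{B}:\mathbb{R}^n\to\mathbb{R}\cup\{+\infty\}$ be the function (the logarithmic barrier associated with the half-space $\{x\in\mathbb{R}^n \mid a^\top x\le b\}$) defined by $$(\forall u\in\mathbb{R}^n)\quad \mathcal{B}(u)=\begin{cases}-\ln(b-a^\top u) & \text{if } a^\top u<b,\\ +\infty & \text{otherwise.}\end{cases}$$ Then, for every $x\in\mathbb{R}^n$, the proximity operator $\varphi(x,\mu,\gamma)=\mathrm{prox}_{\gamma\mu\mathcal{B}}(x)$ of $\gamma\mu\mathcal{B}$ at $x$ is given by $$\varphi(x,\mu,\gamma)=x+\frac{b-a^\top x-\sqrt{(b-a^\top x)^2+4\gamma\mu\|a\|^2}}{2\|a\|^2}\,a.$$ In addition, the Jacobian matrix of $\varphi$ with respect to $x$ and the gradients (derivatives) of $\varphi$ with respect to $\mu$ and $\gamma$ are given by $$J_\varphi^{(x)}(x,\mu,\gamma)=\mathbb{I}_n-\frac{1}{2\|a\|^2}\left(1+\frac{a^\top x-b}{\sqrt{(b-a^\top x)^2+4\gamma\mu\|a\|^2}}\right)aa^\top,$$ $$\nabla_\varphi^{(\mu)}(x,\mu,\gamma)=\frac{-\gamma}{\sqrt{(b-a^\top x)^2+4\gamma\mu\|a\|^2}}\,a,$$ $$\nabla_\varphi^{(\gamma)}(x,\mu,\gamma)=\frac{-\mu}{\sqrt{(b-a^\top x)^2+4\gamma\mu\|a\|^2}}\,a,$$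 where $\mathbb{I}_n\in\mathbb{R}^{n\times n}$ denotes the identity matrix.
   Context: $\|\cdot\|$ is the Euclidean norm on $\mathbb{R}^n$. For a proper, convex, lower semicontinuous function $g:\mathbb{R}^n\to\mathbb{R}\cup\{+\infty\}$ and $t>0$, the proximity operator of $tg$ at $x\in\mathbb{R}^n$ is the unique minimizer $\mathrm{prox}_{tg}(x)=\operatorname{argmin}_{u\in\mathbb{R}^n}\ \frac12\|x-u\|^2+t\,g(u)$. The map $\varphi$ is regarded as a function of $(x,\mu,\gamma)\in\mathbb{R}^n\times\,]0,+\infty[\,\times\,]0,+\infty[$ with values in $\mathbb{R}^n$. $J_\varphi^{(x)}$ denotes its Jacobian matrix with respect to $x$, and $\nabla_\varphi^{(\mu)},\nabla_\varphi^{(\gamma)}\in\mathbb{R}^n$ denote its partial derivatives with respect to the scalars $\mu$ and $\gamma$. *)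

theory Defs
  imports "HOL-Analysis.Analysis"
begin

definition prox_objective :: "('a::real_inner \<Rightarrow> ereal) \<Rightarrow> 'a \<Rightarrow> 'a \<Rightarrow> ereal" where
  "prox_objective g x u = ereal (1/2 * (norm (x - u))\<^sup>2) + g u"

definition is_prox_point :: "('a::real_inner \<Rightarrow> ereal) \<Rightarrow> 'a \<Rightarrow> 'a \<Rightarrow> bool" where
  "is_prox_point g x u \<longleftrightarrow> is_arg_min (prox_objective g x) (\<lambda>_. True) u"

(* Meaningful only if the minimizer exists and is unique, as it does for
   proper, convex, lower semicontinuous g on a Euclidean space. *)
definition prox :: "('a::real_inner \<Rightarrow> ereal) \<Rightarrow> 'a \<Rightarrow> 'a" where
  "prox g x = (THE u. is_prox_point g x u)"

definition log_barrier :: "real^'n \<Rightarrow> real \<Rightarrow> real^'n \<Rightarrow> ereal" where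
  "log_barrier a b u = (if a \<bullet> u < b then ereal (- ln (b - a \<bullet> u)) else \<infinity>)"

(* Intended for mu, gamma > 0, where the ereal product is infinite outside the
   open half-space. *)
definition scaled_log_barrier :: "real^'n \<Rightarrow> real \<Rightarrow> real \<Rightarrow> real \<Rightarrow> real^'n \<Rightarrow> ereal" where
  "scaled_log_barrier a b \<mu> \<gamma> u = ereal (\<gamma> * \<mu>) * log_barrier a b u"

definition barrier_prox :: "real^'n \<Rightarrow> real \<Rightarrow> real^'n \<Rightarrow> real \<Rightarrow> real \<Rightarrow> real^'n" where
  "barrier_prox a b x \<mu> \<gamma> = prox (scaled_log_barrier a b \<mu> \<gamma>) x"

definition outer_product :: "real^'m \<Rightarrow> real^'n \<Rightarrow> real^'n^'m" where
  "outer_product v w = (\<chi> i j. v $ i * w $ j)"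

end

theory Submission
  imports Defs
begin

text \<open>
  Only the slack \<open>s = b - a \<bullet> x\<close> to the bounding hyperplane matters. Write
  \<open>c = \<gamma> * \<mu>\<close>. The gradient of the barrier is a multiple of \<open>a\<close>, so stationarity
  forces the minimizer to be \<open>p = x - (c / d) *\<^sub>R a\<close>, where \<open>d = b - a \<bullet> p\<close> is its own
  slack. Taking inner products with \<open>a\<close> gives \<open>d\<^sup>2 - s * d - c * (norm a)\<^sup>2 = 0\<close>, whose
  positive root is \<open>d = (s + sqrt (s\<^sup>2 + 4 * c * (norm a)\<^sup>2)) / 2\<close>. Hence \<open>p - x\<close> is the
  multiple of \<open>a\<close> called \<open>barrier_step\<close> below.

  Global optimality and uniqueness come together from one inequality. Expanding
  \<open>(norm (x - u))\<^sup>2\<close> around \<open>p\<close>, the cross term is \<open>c * (e / d - 1)\<close> with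
  \<open>e = b - a \<bullet> u\<close>, and \<open>ln (e / d) \<le> e / d - 1\<close> shows that it absorbs the change of the
  barrier. The objective at \<open>u\<close> therefore exceeds its value at \<open>p\<close> by at least
  \<open>(norm (u - p))\<^sup>2 / 2\<close> (\<open>barrier_objective_growth\<close>).

  The prox being explicit, the three derivatives reduce by the chain rule to the two partial
  derivatives of \<open>barrier_step\<close>, since \<open>x\<close> enters only through \<open>s\<close> (and additively), and
  \<open>\<mu>\<close>, \<open>\<gamma>\<close> only through \<open>c\<close>. The discriminant stays positive because \<open>c > 0\<close> and
  \<open>a \<noteq> 0\<close>, so the square root is differentiable there.
\<close>

text \<open>With \<open>N = (norm a)\<^sup>2\<close> and \<open>c > 0\<close>, this is the coefficient \<open>t\<close> of the displacement
  \<open>p - x = t *\<^sub>R a\<close>; it is the negative root of \<open>N * t\<^sup>2 - s * t - c = 0\<close>.\<close>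

definition barrier_step :: "real \<Rightarrow> real \<Rightarrow> real \<Rightarrow> real" where
  "barrier_step N c s = (s - sqrt (s\<^sup>2 + 4 * c * N)) / (2 * N)"

lemma discriminant_pos:
  fixes N c s :: real
  assumes "N > 0" "c > 0"
  shows "s\<^sup>2 + 4 * c * N > 0"
  using assms by (intro add_nonneg_pos) auto

text \<open>After the displacement the slack drops from \<open>s\<close> to \<open>s - N * t\<close>: it is positive, so the
  new point is feasible, and the second part is the stationarity condition.\<close>

lemma barrier_step_stationary:
  assumes "N > 0" "c > 0"
  shows "s - N * barrier_step N c s > 0"
    and "barrier_step N c s * (s - N * barrier_step N c s) = - c"
proof -
  define r where "r = sqrt (s\<^sup>2 + 4 * c * N)"
  have r2: "r\<^sup>2 = s\<^sup>2 + 4 * c * N"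
    unfolding r_def using discriminant_pos[OF assms, of s] by simp
  have "\<bar>s\<bar> < r"
    unfolding r_def using assms by (intro real_less_rsqrt) simp
  have step: "barrier_step N c s = (s - r) / (2 * N)"
    by (simp add: barrier_step_def r_def)
  have slack: "s - N * barrier_step N c s = (s + r) / 2"
    unfolding step using assms by (simp add: field_simps)
  show "s - N * barrier_step N c s > 0"
    unfolding slack using \<open>\<bar>s\<bar> < r\<close> by simp
  have "barrier_step N c s * (s - N * barrier_step N c s) = (s\<^sup>2 - r\<^sup>2) / (4 * N)"
    unfolding slack unfolding step by (simp add: field_simps power2_eq_square)
  also have "\<dots> = - c"
    unfolding r2 using assms by simp
  finally show "barrier_step N c s * (s - N * barrier_step N c s) = - c" .
qed

lemma has_derivative_barrier_step_slack:
  assumes "N > 0" "c > 0"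
  shows "(barrier_step N c has_real_derivative
           (1 - s / sqrt (s\<^sup>2 + 4 * c * N)) / (2 * N)) (at s)"
  unfolding barrier_step_def
  using assms discriminant_pos[OF assms, of s]
  by (auto intro!: derivative_eq_intros simp: divide_simps)

lemma has_derivative_barrier_step_weight:
  assumes "N > 0" "c > 0"
  shows "((\<lambda>c. barrier_step N c s) has_real_derivative
           - 1 / sqrt (s\<^sup>2 + 4 * c * N)) (at c)"
  unfolding barrier_step_def
  using assms discriminant_pos[OF assms, of s]
  by (auto intro!: derivative_eq_intros simp: divide_simps)

text \<open>At a feasible stationary point \<open>p\<close>, strong convexity of the quadratic term and convexity
  of \<open>- ln\<close> combine into quadratic growth on the whole half-space.\<close>

lemma barrier_objective_growth:
  fixes a x u p :: "'a::real_inner"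
  assumes "c > 0" "a \<bullet> u < b" "a \<bullet> p < b"
    and stationary: "x - p = (c / (b - a \<bullet> p)) *\<^sub>R a"
  shows "1/2 * (norm (x - p))\<^sup>2 - c * ln (b - a \<bullet> p) + 1/2 * (norm (u - p))\<^sup>2
           \<le> 1/2 * (norm (x - u))\<^sup>2 - c * ln (b - a \<bullet> u)"
proof -
  define d e where "d = b - a \<bullet> p" and "e = b - a \<bullet> u"
  have pos: "d > 0" "e > 0"
    using assms by (auto simp: d_def e_def)
  have "c * (ln e - ln d) \<le> c * (e / d - 1)"
    using ln_le_minus_one[of "e / d"] pos \<open>c > 0\<close>
    by (intro mult_left_mono) (auto simp: ln_div)
  moreover have "(x - p) \<bullet> (p - u) = c / d * (e - d)"
    unfolding stationary by (simp add: d_def e_def inner_diff_right[symmetric])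
  then have "(x - p) \<bullet> (p - u) = c * (e / d - 1)"
    using pos by (simp add: field_simps)
  moreover have "(norm (x - u))\<^sup>2
      = (norm (x - p))\<^sup>2 + 2 * ((x - p) \<bullet> (p - u)) + (norm (u - p))\<^sup>2"
    by (simp add: power2_norm_eq_inner inner_diff_left inner_diff_right inner_commute)
  ultimately show ?thesis
    by (simp add: d_def e_def algebra_simps)
qed

lemma prox_objective_scaled_log_barrier:
  fixes a x u :: "real^'n"
  assumes "\<gamma> > 0" "\<mu> > 0"
  shows "prox_objective (scaled_log_barrier a b \<mu> \<gamma>) x u =
           (if a \<bullet> u < b
            then ereal (1/2 * (norm (x - u))\<^sup>2 - \<gamma> * \<mu> * ln (b - a \<bullet> u)) else \<infinity>)"
  using assms by (simp add: prox_objective_def scaled_log_barrier_def log_barrier_def)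

lemma is_prox_point_iff:
  "is_prox_point g x u \<longleftrightarrow> (\<forall>v. prox_objective g x u \<le> prox_objective g x v)"
  by (auto simp: is_prox_point_def is_arg_min_def not_less)

lemma is_prox_point_scaled_log_barrier_iff:
  fixes a x u :: "real^'n"
  assumes "a \<noteq> 0" "\<gamma> > 0" "\<mu> > 0"
  shows "is_prox_point (scaled_log_barrier a b \<mu> \<gamma>) x u \<longleftrightarrow>
           u = x + barrier_step ((norm a)\<^sup>2) (\<gamma> * \<mu>) (b - a \<bullet> x) *\<^sub>R a"
proof -
  define t where "t = barrier_step ((norm a)\<^sup>2) (\<gamma> * \<mu>) (b - a \<bullet> x)"
  define p where "p = x + t *\<^sub>R a"
  define F where "F = prox_objective (scaled_log_barrier a b \<mu> \<gamma>) x"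
  have pos: "(norm a)\<^sup>2 > 0" "\<gamma> * \<mu> > 0"
    using assms by auto
  have slack: "b - a \<bullet> p = b - a \<bullet> x - (norm a)\<^sup>2 * t"
    by (simp add: p_def inner_add_right power2_norm_eq_inner)
  have feasible: "a \<bullet> p < b"
    using barrier_step_stationary(1)[OF pos, of "b - a \<bullet> x"] slack by (simp add: t_def)
  have "t * (b - a \<bullet> p) = - (\<gamma> * \<mu>)"
    unfolding slack t_def by (rule barrier_step_stationary(2)[OF pos])
  then have "- t = \<gamma> * \<mu> / (b - a \<bullet> p)"
    using feasible by (simp add: field_simps)
  then have stationary: "x - p = (\<gamma> * \<mu> / (b - a \<bullet> p)) *\<^sub>R a"
    by (metis add_diff_cancel_left' minus_diff_eq p_def scaleR_minus_left)
  have growth: "F p + ereal (1/2 * (norm (v - p))\<^sup>2) \<le> F v" for v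
    using feasible barrier_objective_growth[OF pos(2) _ feasible stationary, of v]
    by (simp add: F_def prox_objective_scaled_log_barrier assms)
  have "F p \<le> F v" for v
    using growth[of v] by (intro order_trans[OF _ growth] ereal_le_add_self) simp
  moreover have "u = p" if "F u \<le> F p"
  proof -
    \<comment> \<open>The value at \<open>p\<close> is finite, so it cancels from the growth inequality.\<close>
    obtain f where f: "F p = ereal f"
      using feasible by (simp add: F_def prox_objective_scaled_log_barrier assms)
    have "F p + ereal (1/2 * (norm (u - p))\<^sup>2) \<le> F p"
      using growth[of u] that by (rule order_trans)
    then show "u = p"
      by (simp add: f)
  qed
  ultimately show ?thesis
    unfolding is_prox_point_iff F_def[symmetric] t_def[symmetric] p_def[symmetric] by blast
qed

lemma barrier_prox_eq:
  fixes a x :: "real^'n"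
  assumes "a \<noteq> 0" "\<gamma> > 0" "\<mu> > 0"
  shows "barrier_prox a b x \<mu> \<gamma> =
           x + barrier_step ((norm a)\<^sup>2) (\<gamma> * \<mu>) (b - a \<bullet> x) *\<^sub>R a"
  using assms by (simp add: barrier_prox_def prox_def is_prox_point_scaled_log_barrier_iff)

lemma outer_product_mult_vector:
  fixes v :: "real^'m" and w h :: "real^'n"
  shows "outer_product v w *v h = (w \<bullet> h) *\<^sub>R v"
  by (simp add: vec_eq_iff outer_product_def matrix_vector_mult_def inner_vec_def
      sum_distrib_left sum_distrib_right mult_ac)

lemma has_derivative_barrier_prox_point:
  fixes a x :: "real^'n"
  assumes "a \<noteq> 0" "\<gamma> > 0" "\<mu> > 0"
  shows "((\<lambda>y. barrier_prox a b y \<mu> \<gamma>) has_derivative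
           (\<lambda>h. (mat 1 - (1 / (2 * (norm a)\<^sup>2) *
                    (1 + (a \<bullet> x - b) / sqrt ((b - a \<bullet> x)\<^sup>2 + 4 * \<gamma> * \<mu> * (norm a)\<^sup>2)))
                  *\<^sub>R outer_product a a) *v h)) (at x)"
proof -
  define N c where "N = (norm a)\<^sup>2" and "c = \<gamma> * \<mu>"
  define D where "D = (1 - (b - a \<bullet> x) / sqrt ((b - a \<bullet> x)\<^sup>2 + 4 * c * N)) / (2 * N)"
  have "N > 0" "c > 0"
    using assms by (auto simp: N_def c_def)
  then have outer: "(barrier_step N c has_derivative (*) D) (at (b - a \<bullet> x))"
    using has_derivative_barrier_step_slack[of N c "b - a \<bullet> x"]
    by (simp add: D_def has_field_derivative_def)
  have "((\<lambda>y. b - a \<bullet> y) has_derivative (\<lambda>h. - (a \<bullet> h))) (at x)"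
    by (auto intro!: derivative_eq_intros)
  from has_derivative_compose[OF this outer]
  have "((\<lambda>y. y + barrier_step N c (b - a \<bullet> y) *\<^sub>R a) has_derivative
          (\<lambda>h. h + (D * - (a \<bullet> h)) *\<^sub>R a)) (at x)"
    by (intro has_derivative_add has_derivative_ident has_derivative_scaleR_left)
  moreover have "h + (D * - (a \<bullet> h)) *\<^sub>R a =
      (mat 1 - (1 / (2 * (norm a)\<^sup>2) *
          (1 + (a \<bullet> x - b) / sqrt ((b - a \<bullet> x)\<^sup>2 + 4 * \<gamma> * \<mu> * (norm a)\<^sup>2)))
        *\<^sub>R outer_product a a) *v h" for h
  proof -
    have "1 / (2 * (norm a)\<^sup>2) *
        (1 + (a \<bullet> x - b) / sqrt ((b - a \<bullet> x)\<^sup>2 + 4 * \<gamma> * \<mu> * (norm a)\<^sup>2)) = D"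
      by (simp add: D_def N_def c_def mult.assoc diff_divide_distrib add_divide_distrib)
    then show ?thesis
      by (simp add: matrix_vector_mult_diff_rdistrib scaleR_matrix_vector_assoc[symmetric]
          outer_product_mult_vector mult.commute)
  qed
  ultimately show ?thesis
    using assms by (simp add: barrier_prox_eq N_def c_def)
qed

text \<open>The closed form is available only for positive parameters, which is enough since they
  form a neighbourhood of \<open>\<mu>\<close>.\<close>

lemma has_vector_derivative_barrier_prox_mu:
  fixes a x :: "real^'n"
  assumes "a \<noteq> 0" "\<gamma> > 0" "\<mu> > 0"
  shows "((\<lambda>m. barrier_prox a b x m \<gamma>) has_vector_derivative
           (- \<gamma> / sqrt ((b - a \<bullet> x)\<^sup>2 + 4 * \<gamma> * \<mu> * (norm a)\<^sup>2)) *\<^sub>R a) (at \<mu>)"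
proof -
  have pos: "(norm a)\<^sup>2 > 0" "\<gamma> * \<mu> > 0"
    using assms by auto
  have "((\<lambda>m. barrier_step ((norm a)\<^sup>2) (\<gamma> * m) (b - a \<bullet> x)) has_real_derivative
          - 1 / sqrt ((b - a \<bullet> x)\<^sup>2 + 4 * (\<gamma> * \<mu>) * (norm a)\<^sup>2) * \<gamma>) (at \<mu>)"
    by (rule DERIV_chain2[where g = "\<lambda>m. \<gamma> * m" and x = \<mu>,
          OF has_derivative_barrier_step_weight[OF pos]])
       (auto intro!: derivative_eq_intros)
  then have "((\<lambda>m. x + barrier_step ((norm a)\<^sup>2) (\<gamma> * m) (b - a \<bullet> x) *\<^sub>R a)
      has_vector_derivative
        (- \<gamma> / sqrt ((b - a \<bullet> x)\<^sup>2 + 4 * \<gamma> * \<mu> * (norm a)\<^sup>2)) *\<^sub>R a) (at \<mu>)"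
    by (auto intro!: derivative_eq_intros simp: mult.assoc)
  then show ?thesis
    by (rule has_vector_derivative_transform_within_open[where S = "{0<..}"])
       (use assms in \<open>auto simp: barrier_prox_eq\<close>)
qed

lemma barrier_prox_swap: "barrier_prox a b x \<mu> \<gamma> = barrier_prox a b x \<gamma> \<mu>"
  by (simp add: barrier_prox_def scaled_log_barrier_def[abs_def] mult.commute)

theorem proposition1:
  fixes a x :: "real^'n" and b \<mu> \<gamma> :: real
  assumes "a \<noteq> 0" and "\<gamma> > 0" and "\<mu> > 0"
  shows "(\<exists>!u. is_prox_point (scaled_log_barrier a b \<mu> \<gamma>) x u) \<and>
         (barrier_prox a b x \<mu> \<gamma> =
           x + ((b - a \<bullet> x - sqrt ((b - a \<bullet> x)\<^sup>2 + 4 * \<gamma> * \<mu> * (norm a)\<^sup>2))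
                / (2 * (norm a)\<^sup>2)) *\<^sub>R a) \<and>
         (((\<lambda>y. barrier_prox a b y \<mu> \<gamma>) has_derivative
            (\<lambda>h. (mat 1 - (1 / (2 * (norm a)\<^sup>2) *
                     (1 + (a \<bullet> x - b) / sqrt ((b - a \<bullet> x)\<^sup>2 + 4 * \<gamma> * \<mu> * (norm a)\<^sup>2)))
                   *\<^sub>R outer_product a a) *v h)) (at x)) \<and>
         (((\<lambda>m. barrier_prox a b x m \<gamma>) has_vector_derivative
            (- \<gamma> / sqrt ((b - a \<bullet> x)\<^sup>2 + 4 * \<gamma> * \<mu> * (norm a)\<^sup>2)) *\<^sub>R a) (at \<mu>)) \<and>
         (((\<lambda>g. barrier_prox a b x \<mu> g) has_vector_derivative
            (- \<mu> / sqrt ((b - a \<bullet> x)\<^sup>2 + 4 * \<gamma> * \<mu> * (norm a)\<^sup>2)) *\<^sub>R a) (at \<gamma>))"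
proof (intro conjI)
  show "\<exists>!u. is_prox_point (scaled_log_barrier a b \<mu> \<gamma>) x u"
    using assms by (simp add: is_prox_point_scaled_log_barrier_iff)
  show "barrier_prox a b x \<mu> \<gamma> =
      x + ((b - a \<bullet> x - sqrt ((b - a \<bullet> x)\<^sup>2 + 4 * \<gamma> * \<mu> * (norm a)\<^sup>2))
           / (2 * (norm a)\<^sup>2)) *\<^sub>R a"
    using assms by (simp add: barrier_prox_eq barrier_step_def mult.assoc)
  show "((\<lambda>g. barrier_prox a b x \<mu> g) has_vector_derivative
      (- \<mu> / sqrt ((b - a \<bullet> x)\<^sup>2 + 4 * \<gamma> * \<mu> * (norm a)\<^sup>2)) *\<^sub>R a) (at \<gamma>)"
    using has_vector_derivative_barrier_prox_mu[OF assms(1,3,2), of b x]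
    by (simp add: barrier_prox_swap[of a b x \<mu>] mult_ac)
qed (rule has_derivative_barrier_prox_point[OF assms]
      has_vector_derivative_barrier_prox_mu[OF assms])+

end
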